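(* Let $a,b,c,\mu\in\mathbb{C}$ with $c\notin\mathbb{Z}_{\le0}$ and $\operatorname{Re}(c-a)>\operatorname{Re}\mu>0$. Then for all $x\in(-\infty,0)\cup(0,1)$ $$\int_{0<y/x<1}|y|^{c-a-\mu-1}(1-y)^{a+b-c}\,{}_2F_1(a,b;c;y)\,\frac{|x-y|^{\mu-1}}{\Gamma(\mu)}\,dy=\frac{\Gamma(c-a-\mu)}{\Gamma(c-a)}\,|x|^{c-a-1}(1-x)^{a+b-c+\mu}\,{}_2F_1(a+\mu,b;c;x),$$ where the integral is over the open interval with endpoints $0$ and $x$ (with respect to Lebesgue measure).
   Context: ${}_2F_1(a,b;c;z)$ denotes the Gauss hypergeometric function, defined for $|z|<1$ by $\sum_{k\ge0}\frac{(a)_k(b)_k}{(c)_k\,k!}z^k$ (with $c\notin\mathbb{Z}_{\le0}$) and extended by its one-valued analytic continuation to $\mathbb{C}\setminus[1,\infty)$. *)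

theory Defs
  imports "HOL-Complex_Analysis.Complex_Analysis"
begin

text \<open>
  By the identity theorem the two conditions determine the function uniquely on the slit plane;
  its values on the cut \<open>[1,\<infinity>)\<close> are left unspecified.
\<close>
definition hyp2F1 :: "complex \<Rightarrow> complex \<Rightarrow> complex \<Rightarrow> complex \<Rightarrow> complex" where
  "hyp2F1 a b c = (SOME F.
     F holomorphic_on (UNIV - complex_of_real ` {1..}) \<and>
     (\<forall>z. norm z < 1 \<longrightarrow>
        (\<lambda>k. pochhammer a k * pochhammer b k / (pochhammer c k * fact k) * z ^ k) sums F z))"

end

theory Submission imports Defs begin

text \<open>
  By Euler's transformation \<open>(1 - y)\<^bsup>a + b - c\<^esup> F(a, b; c; y) = F(c - a, c - b; c; y)\<close> and the
  substitution \<open>y = x t\<close>, the integral becomes a multiple of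
  \<open>\<integral> t\<^bsup>\<alpha> - 1\<^esup> (1 - t)\<^bsup>\<mu> - 1\<^esup> F(\<alpha> + \<mu>, c - b; c; x t) dt\<close> over \<open>(0, 1)\<close>, where \<open>\<alpha> = c - a - \<mu>\<close>.
  As a function of \<open>x\<close> this is holomorphic on the plane slit along \<open>[1, \<infinity>)\<close>, which is starlike with
  respect to \<open>0\<close>, and it multiplies the \<open>k\<close>-th Taylor coefficient by
  \<open>B(\<alpha>, \<mu>) (\<alpha>)\<^sub>k / (\<alpha> + \<mu>)\<^sub>k\<close>; hence it equals \<open>B(\<alpha>, \<mu>) F(\<alpha>, c - b; c; x)\<close>, and a second Euler
  transformation finishes the proof.

  The same integral operator, together with \<open>f \<mapsto> f + z f' / c\<close> and a shift of the coefficients, carries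
  \<open>(1 - z)\<^bsup>-a\<^esup>\<close> to \<open>F(a, b; c; z)\<close>, so the analytic continuation to the slit plane exists
  for all parameters.
\<close>

subsection \<open>The complex Beta integral\<close>

lemma pos_Re_not_nonpos_Int: "Re z > 0 \<Longrightarrow> z \<notin> \<int>\<^sub>\<le>\<^sub>0"
  by (auto elim!: nonpos_Ints_cases')

text \<open>On positive arguments the power is \<open>exp (z * ln g)\<close>, and the indicator
  hides everything else, so the branch cut of \<open>powr\<close> never enters. As a measurability
  rule it covers any product of such truncated powers.\<close>

lemma borel_measurable_of_real_powr [measurable]:
  fixes g :: "'a \<Rightarrow> real" and z :: complex
  assumes [measurable]: "g \<in> borel_measurable M"
  shows "(\<lambda>x. indicator {0<..} (g x) *\<^sub>R (of_real (g x) powr z :: complex)) \<in> borel_measurable M"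
proof -
  have "(\<lambda>x. indicator {0<..} (g x) *\<^sub>R (of_real (g x) powr z :: complex)) =
        (\<lambda>x. indicator {0<..} (g x) *\<^sub>R exp (z * of_real (ln (g x))))"
    by (auto simp: fun_eq_iff powr_def indicator_def Ln_of_real)
  thus ?thesis by simp
qed

text \<open>Absolute integrability refers to the completed Lebesgue measure; Borel measurability of
  the integrand brings it down to \<open>lborel\<close>, the measure in which Fubini is applied
  below.\<close>

lemma Gamma_lborel_integral:
  assumes z: "Re z > 0"
  shows "integrable lborel (\<lambda>t. indicator {0<..} t *\<^sub>R (of_real t powr (z - 1) / of_real (exp t)))"
    and "(\<integral>t. indicator {0<..} t *\<^sub>R (of_real t powr (z - 1) / of_real (exp t)) \<partial>lborel) = Gamma z"
proof -
  let ?f = "\<lambda>t. indicator {0<..} t *\<^sub>R (of_real t powr (z - 1) / of_real (exp t) :: complex)"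
  have "(\<lambda>t. (indicator {0<..} t *\<^sub>R (of_real t powr (z - 1) :: complex)) / of_real (exp t)) \<in> borel_measurable borel"
    by measurable
  also have "(\<lambda>t. (indicator {0<..} t *\<^sub>R (of_real t powr (z - 1) :: complex)) / of_real (exp t)) = ?f"
    by (auto simp: indicator_def)
  finally have "?f \<in> borel_measurable lborel" by simp
  thus int: "integrable lborel ?f"
    using absolutely_integrable_Gamma_integral'[OF z]
    by (simp add: set_integrable_def integrable_completion)
  show "integral\<^sup>L lborel ?f = Gamma z"
    using set_borel_integral_eq_integral[of "{0<..}" "\<lambda>t. of_real t powr (z - 1) / of_real (exp t)"] int
      Gamma_integral_complex'[OF z]
    by (simp add: set_integrable_def set_lebesgue_integral_def has_integral_iff)
qed

text \<open>The integrand of Euler's Beta integral, truncated factor by factor: this makes it a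
  total function vanishing off (0, 1) and matches the measurability rule for truncated
  powers.\<close>

definition beta_kernel :: "complex \<Rightarrow> complex \<Rightarrow> real \<Rightarrow> complex" where
  "beta_kernel a b t =
     (indicator {0<..} t *\<^sub>R of_real t powr (a - 1)) * (indicator {0<..} (1 - t) *\<^sub>R of_real (1 - t) powr (b - 1))"

lemma beta_kernel_measurable [measurable]: "beta_kernel a b \<in> borel_measurable borel"
  unfolding beta_kernel_def by measurable

lemma beta_kernel_eq_0: "t \<notin> {0<..<1} \<Longrightarrow> beta_kernel a b t = 0"
  by (auto simp: beta_kernel_def)

lemma beta_kernel_eq: "t \<in> {0<..<1} \<Longrightarrow> beta_kernel a b t = of_real t powr (a - 1) * of_real (1 - t) powr (b - 1)"
  by (auto simp: beta_kernel_def)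

lemma beta_kernel_mult_power: "beta_kernel a b t * of_real t ^ k = beta_kernel (a + of_nat k) b t"
proof (cases "t \<in> {0<..<1}")
  case True
  have "of_real t powr (a - 1 + of_nat k) = of_real t powr (a - 1) * (of_real t :: complex) ^ k"
    using True by (subst powr_add) (simp add: powr_nat)
  hence "of_real t powr (a + of_nat k - 1) = of_real t powr (a - 1) * (of_real t :: complex) ^ k"
    by (simp add: algebra_simps)
  thus ?thesis using True by (simp add: beta_kernel_eq)
qed (simp add: beta_kernel_eq_0)

lemma integrable_beta_kernel:
  assumes "Re a > 0" "Re b > 0"
  shows "integrable lborel (beta_kernel a b)"
proof (rule Bochner_Integration.integrable_bound)
  show "integrable lborel (\<lambda>t. indicator {0..1} t *\<^sub>R (t powr (Re a - 1) * (1 - t) powr (Re b - 1)))"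
    using integrable_Beta[OF assms] by (simp add: set_integrable_def)
  show "AE t in lborel. norm (beta_kernel a b t) \<le>
          norm (indicator {0..1} t *\<^sub>R (t powr (Re a - 1) * (1 - t) powr (Re b - 1)))"
  proof (rule AE_I2)
    fix t show "norm (beta_kernel a b t) \<le>
          norm (indicator {0..1} t *\<^sub>R (t powr (Re a - 1) * (1 - t) powr (Re b - 1)))"
      by (cases "t \<in> {0<..<1}")
         (simp_all add: beta_kernel_eq beta_kernel_eq_0 norm_mult norm_powr_real_powr del: of_real_diff)
  qed
qed simp

text \<open>The function s^(a-1) (v-s)^(b-1) e^(-v) on 0 < s < v is integrated in both orders.
  Rescaling s = v t gives Gamma(a+b) times the wanted integral, while translating v = s + u gives
  Gamma(a) Gamma(b).\<close>

theorem integral_beta_kernel: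
  assumes a: "Re a > 0" and b: "Re b > 0"
  shows "(\<integral>t. beta_kernel a b t \<partial>lborel) = Beta a b"
proof -
  define G :: "complex \<Rightarrow> real \<Rightarrow> complex"
    where "G = (\<lambda>z t. indicator {0<..} t *\<^sub>R (of_real t powr (z - 1) / of_real (exp t)))"
  have G: "integrable lborel (G z)" "integral\<^sup>L lborel (G z) = Gamma z" if "Re z > 0" for z
    using Gamma_lborel_integral[OF that] by (simp_all add: G_def)
  define h where "h = (\<lambda>v s. (indicator {0<..} s *\<^sub>R of_real s powr (a - 1)) *
     (indicator {0<..} (v - s) *\<^sub>R of_real (v - s) powr (b - 1)) / (of_real (exp v) :: complex))"
  have hmeas: "case_prod h \<in> borel_measurable (lborel \<Otimes>\<^sub>M lborel)"
    unfolding h_def by measurable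
  \<comment> \<open>The argument has the shape of the affine substitution rule with offset 0; the
    division by \<open>v\<close> will cancel against the Jacobian.\<close>
  have h_scale: "h v (0 + v * t) = G (a + b) v * beta_kernel a b t / of_real v" if v: "v > 0" for v t
  proof (cases "t \<in> {0<..<1}")
    case True
    have "v - v * t = v * (1 - t)" by (simp add: algebra_simps)
    hence "h v (0 + v * t) = of_real (v * t) powr (a - 1) * of_real (v * (1 - t)) powr (b - 1) / of_real (exp v)"
      using True v by (simp add: h_def del: of_real_diff of_real_mult)
    also have "\<dots> = (of_real v powr (a - 1) * of_real v powr (b - 1)) * beta_kernel a b t / of_real (exp v)"
      using True v unfolding of_real_mult by (simp add: powr_times_real beta_kernel_eq del: of_real_diff)
    also have "of_real v powr (a - 1) * of_real v powr (b - 1) = of_real v powr (a + b - 1) / (of_real v :: complex)"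
      using v by (simp add: powr_diff powr_add field_simps)
    finally show ?thesis using v by (simp add: G_def)
  next
    case False
    have "v * t \<le> 0 \<or> v - v * t \<le> 0"
      using False v by (auto simp: mult_le_0_iff)
    with False show ?thesis by (auto simp: h_def beta_kernel_eq_0)
  qed
  have h0: "h v s = 0" if "v \<le> 0" for v s
    using that by (auto simp: h_def indicator_def)
  have inth: "integrable lborel (h v)" for v
  proof (cases "v > 0")
    case True
    hence "integrable lborel (\<lambda>t. h v (0 + v * t))"
      unfolding h_scale[OF True] by (intro integrable_divide_zero integrable_mult_right integrable_beta_kernel a b)
    thus ?thesis using True by (subst (asm) lborel_integrable_real_affine_iff) auto
  next
    case False
    hence "h v = (\<lambda>_. 0)" by (auto simp: h0)
    thus ?thesis by simp
  qed
  have I1: "(\<integral>s. h v s \<partial>lborel) = G (a + b) v * (\<integral>t. beta_kernel a b t \<partial>lborel)" for v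
  proof (cases "v > 0")
    case True
    show ?thesis
      using True by (subst lborel_integral_real_affine[of v _ 0])
        (simp_all only: h_scale[OF True], simp_all add: scaleR_conv_of_real)
  next
    case False thus ?thesis by (simp add: h0 G_def)
  qed
  \<comment> \<open>The same rescaling applied to norms yields absolute integrability of
    \<open>h\<close> on the plane, which justifies Fubini.\<close>
  have I1n: "(\<integral>s. norm (h v s) \<partial>lborel) = norm (G (a + b) v) * (\<integral>t. norm (beta_kernel a b t) \<partial>lborel)" for v
  proof (cases "v > 0")
    case True
    show ?thesis
      using True by (subst lborel_integral_real_affine[of v _ 0])
        (simp_all only: h_scale[OF True], simp_all add: norm_mult norm_divide)
  next
    case False thus ?thesis by (simp add: h0 G_def)
  qed
  have int2: "integrable (lborel \<Otimes>\<^sub>M lborel) (case_prod h)"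
  proof (rule lborel_pair.Fubini_integrable[OF hmeas])
    have "Re (a + b) > 0" using a b by simp
    thus "integrable lborel (\<lambda>v. \<integral>s. norm (case_prod h (v, s)) \<partial>lborel)"
      unfolding prod.case I1n by (intro integrable_mult_left integrable_norm G)
  qed (use inth in auto)
  have I2: "(\<integral>v. h v s \<partial>lborel) = G a s * Gamma b" for s
  proof -
    have "h (s + 1 * u) s = G a s * G b u" for u
      by (simp add: h_def G_def exp_add indicator_def)
    hence "(\<integral>v. h v s \<partial>lborel) = (\<integral>u. G a s * G b u \<partial>lborel)"
      by (subst lborel_integral_real_affine[of 1 _ s]) simp_all
    thus ?thesis using G(2)[OF b] by simp
  qed
  have "Gamma (a + b) * (\<integral>t. beta_kernel a b t \<partial>lborel) = (\<integral>v. \<integral>s. h v s \<partial>lborel \<partial>lborel)"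
    using G(2)[of "a + b"] a b by (simp add: I1)
  also have "\<dots> = (\<integral>s. \<integral>v. h v s \<partial>lborel \<partial>lborel)"
    using lborel_pair.Fubini_integral[OF int2] by simp
  also have "\<dots> = Gamma a * Gamma b"
    using G(2)[OF a] by (simp add: I2)
  finally have "Gamma (a + b) * (\<integral>t. beta_kernel a b t \<partial>lborel) = Gamma a * Gamma b" .
  moreover have "Gamma (a + b) \<noteq> 0"
    using a b by (simp add: Gamma_eq_zero_iff pos_Re_not_nonpos_Int)
  ultimately show ?thesis by (simp add: Beta_def field_simps)
qed

subsection \<open>The slit plane\<close>

abbreviation slit_plane :: "complex set" where
  "slit_plane \<equiv> UNIV - complex_of_real ` {1..}"

text \<open>This is the form needed for principal powers: (1 - z)^s is holomorphic exactly where
  \<open>1 - z\<close> avoids the branch cut by this criterion.\<close>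

lemma slit_plane_iff: "z \<in> slit_plane \<longleftrightarrow> 1 - z \<notin> \<real>\<^sub>\<le>\<^sub>0"
proof -
  have "z \<in> complex_of_real ` {1..} \<longleftrightarrow> 1 - z \<in> \<real>\<^sub>\<le>\<^sub>0"
    by (auto simp: complex_nonpos_Reals_iff complex_eq_iff intro!: image_eqI[of _ _ "Re z"])
  thus ?thesis by simp
qed

lemma open_slit_plane: "open slit_plane"
proof -
  have "closed ((\<lambda>z::complex. 1 - z) -` \<real>\<^sub>\<le>\<^sub>0)"
    by (intro closed_vimage closed_nonpos_Reals_complex continuous_intros)
  also have "(\<lambda>z::complex. 1 - z) -` \<real>\<^sub>\<le>\<^sub>0 = - slit_plane"
    using slit_plane_iff by blast
  finally show ?thesis by (simp only: open_closed)
qed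

lemma zero_in_slit_plane: "0 \<in> slit_plane" by auto

text \<open>If t z = s >= 1 with 0 < t <= 1, then z = s / t >= 1. Starlikeness gives connectedness
  and keeps the arguments z t of the Euler integrals inside the domain.\<close>

lemma segment_subset_slit_plane:
  assumes "z \<in> slit_plane"
  shows "closed_segment 0 z \<subseteq> slit_plane"
proof
  fix y assume "y \<in> closed_segment 0 z"
  then obtain t where t: "0 \<le> t" "t \<le> 1" "y = of_real t * z"
    by (auto simp: in_segment scaleR_conv_of_real)
  show "y \<in> slit_plane"
  proof (rule ccontr)
    assume "y \<notin> slit_plane"
    then obtain s where s: "s \<ge> 1" "of_real t * z = of_real s" using t by auto
    hence "t > 0" using t by (cases "t = 0") auto
    hence "z = of_real (s / t)" using s(2) by (simp add: field_simps)
    moreover have "s / t \<ge> 1" using s t \<open>t > 0\<close> by (simp add: field_simps)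
    ultimately show False using assms by (metis DiffD2 atLeast_iff imageI)
  qed
qed

lemma connected_slit_plane: "connected slit_plane"
  using segment_subset_slit_plane zero_in_slit_plane
  by (intro starlike_imp_connected) (unfold starlike_def, blast)

lemma ball_subset_slit_plane: "ball 0 1 \<subseteq> slit_plane"
  by (auto simp: dist_norm)

text \<open>The identity theorem, applied to the difference. It reduces the later identities between
  hypergeometric functions to identities of formal power series.\<close>

lemma eq_on_slit_plane_if_same_fps:
  assumes "f holomorphic_on slit_plane" "g holomorphic_on slit_plane"
    and "f has_fps_expansion F" "g has_fps_expansion F" "z \<in> slit_plane"
  shows "f z = g z"
proof -
  have "(\<lambda>z. f z - g z) has_fps_expansion F - F"
    by (intro has_fps_expansion_diff assms)
  hence "f z - g z = 0"
    by (intro has_fps_expansion_0_analytic_continuation[where A = slit_plane])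
       (use assms in \<open>auto intro!: holomorphic_intros open_slit_plane connected_slit_plane\<close>)
  thus ?thesis by simp
qed

lemma pochhammer_nz:
  "c \<notin> \<int>\<^sub>\<le>\<^sub>0 \<Longrightarrow> pochhammer (c :: complex) k \<noteq> 0"
  by (auto simp: pochhammer_eq_0_iff)

subsection \<open>Euler integrals as coefficient multipliers\<close>

text \<open>Let M bound |f| on the closed e-neighbourhood of the segment. Cauchy's inequality bounds
  the k-th Taylor coefficient at z0 t by M / e^k, uniformly in t, and |z t - z0 t| <= |z - z0| for t
  in [0, 1]. Hence for |z - z0| < e a geometric series dominates, and sum and integral may be
  exchanged. The resulting expansion in z yields holomorphy without differentiating under the
  integral.\<close>

lemma kernel_integral_power_series:
  fixes w :: "real \<Rightarrow> complex" and f :: "complex \<Rightarrow> complex"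
  assumes w: "integrable lborel w" and w0: "\<And>t. t \<notin> {0..1} \<Longrightarrow> w t = 0"
    and S: "open S" "f holomorphic_on S" "closed_segment 0 z0 \<subseteq> S"
  obtains r where "r > 0"
    "\<And>z. z \<in> ball z0 r \<Longrightarrow> integrable lborel (\<lambda>t. w t * f (z * of_real t))"
    "\<And>z. z \<in> ball z0 r \<Longrightarrow>
       (\<lambda>k. (\<integral>t. w t * (of_real t ^ k * (deriv ^^ k) f (z0 * of_real t) / fact k) \<partial>lborel)
             * (z - z0) ^ k)
       sums (\<integral>t. w t * f (z * of_real t) \<partial>lborel)"
proof -
  define K where "K = closed_segment 0 z0"
  have K: "compact K" "K \<subseteq> S" using S(3) by (auto simp: K_def)
  obtain e where e: "e > 0" "(\<Union>x\<in>K. cball x e) \<subseteq> S"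
    using compact_subset_open_imp_cball_epsilon_subset[OF K(1) S(1) K(2)] by blast
  \<comment> \<open>The neighbourhood is rewritten as the sum of \<open>K\<close> and
    \<open>cball 0 e\<close>, which is compact because both summands are.\<close>
  have "y \<in> (\<Union>x\<in>K. \<Union>d\<in>cball 0 e. {x + d})" if "x \<in> K" "y \<in> cball x e" for x y
    using that by (intro UN_I[of x] UN_I[of "y - x"]) (auto simp: dist_norm norm_minus_commute)
  hence "(\<Union>x\<in>K. \<Union>d\<in>cball 0 e. {x + d}) = (\<Union>x\<in>K. cball x e)"
    by (auto simp: dist_norm)
  hence cpt: "compact (\<Union>x\<in>K. cball x e)"
    using compact_sums'[OF K(1) compact_cball[of 0 e]] by simp
  have "compact (f ` (\<Union>x\<in>K. cball x e))"
    by (intro compact_continuous_image cpt holomorphic_on_imp_continuous_on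
          holomorphic_on_subset[OF S(2) e(2)])
  then obtain M where M: "\<And>y. y \<in> (\<Union>x\<in>K. cball x e) \<Longrightarrow> norm (f y) \<le> M"
    using compact_imp_bounded bounded_iff by (metis imageI)
  have zK: "z0 * of_real t \<in> K" if "t \<in> {0..1}" for t
    using that by (auto simp: K_def in_segment scaleR_conv_of_real mult_ac intro!: exI[of _ t])
  have holb: "f holomorphic_on cball (z0 * of_real t) e" if "t \<in> {0..1}" for t
    using zK[OF that] e(2) by (intro holomorphic_on_subset[OF S(2)]) auto
  have cauchy: "norm ((deriv ^^ k) f (z0 * of_real t)) \<le> fact k * M / e ^ k" if t: "t \<in> {0..1}" for k t
  proof (rule Cauchy_inequality)
    show "f holomorphic_on ball (z0 * of_real t) e"
      by (rule holomorphic_on_subset[OF holb[OF t]]) auto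
    show "continuous_on (cball (z0 * of_real t) e) f"
      by (intro holomorphic_on_imp_continuous_on holb t)
    show "norm (f x) \<le> M" if "norm (z0 * of_real t - x) = e" for x
      using that zK[OF t] by (intro M) (auto simp: dist_norm intro!: bexI[of _ "z0 * of_real t"])
  qed (use e in auto)
  have "0 \<in> (\<Union>x\<in>K. cball x e)"
    using e(1) by (intro UN_I[of 0]) (auto simp: K_def)
  hence M0: "M \<ge> 0" using M[of 0] norm_ge_zero[of "f 0"] by linarith
  have main: "integrable lborel (\<lambda>t. w t * f (z * of_real t)) \<and>
      (\<lambda>k. (\<integral>t. w t * (of_real t ^ k * (deriv ^^ k) f (z0 * of_real t) / fact k) \<partial>lborel)
             * (z - z0) ^ k)
       sums (\<integral>t. w t * f (z * of_real t) \<partial>lborel)" if z: "z \<in> ball z0 e" for z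
  proof -
    define q where "q = norm (z - z0) / e"
    have q: "q \<ge> 0" "q < 1" using z e by (auto simp: q_def dist_norm norm_minus_commute)
    define g where "g = (\<lambda>k t. of_real t ^ k * (deriv ^^ k) f (z0 * of_real t) / fact k * (z - z0) ^ k)"
    \<comment> \<open>The indicator changes nothing, since \<open>w\<close> vanishes off [0, 1], but
      measurability then needs continuity of \<open>g k\<close> on [0, 1] only; outside,
      \<open>z0 * t\<close> may leave \<open>S\<close>.\<close>
    define u where "u = (\<lambda>k t. w t * (indicator {0..1} t *\<^sub>R g k t))"
    have u_eq: "u k t = w t * g k t" for k t
      using w0[of t] by (auto simp: u_def indicator_def)
    have meas: "u k \<in> borel_measurable lborel" for k
    proof -
      have "continuous_on {0..1} (g k)"
        unfolding g_def
        by (intro continuous_intros continuous_on_compose2[OF holomorphic_on_imp_continuous_on[OF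
                  holomorphic_higher_deriv[OF S(2,1)]]])
           (use zK K(2) in auto)
      hence [measurable]: "(\<lambda>t. indicator {0..1} t *\<^sub>R g k t) \<in> borel_measurable borel"
        by (intro borel_measurable_continuous_on_indicator) auto
      have [measurable]: "w \<in> borel_measurable borel"
        using borel_measurable_integrable[OF w] by simp
      show ?thesis unfolding u_def by measurable
    qed
    have bound: "norm (u k t) \<le> norm (w t) * (M * q ^ k)" for k t
    proof (cases "t \<in> {0..1}")
      case True
      have "norm (g k t) = t ^ k * norm ((deriv ^^ k) f (z0 * of_real t)) / fact k * norm (z - z0) ^ k"
        using True by (simp add: g_def norm_mult norm_power norm_divide)
      also have "\<dots> \<le> 1 * (fact k * M / e ^ k) / fact k * norm (z - z0) ^ k"
        using True by (intro mult_right_mono divide_right_mono mult_mono cauchy power_le_one) auto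
      also have "\<dots> = M * q ^ k"
        by (simp add: q_def power_divide)
      finally show ?thesis unfolding u_eq norm_mult by (intro mult_left_mono) auto
    next
      case False
      thus ?thesis by (simp add: u_eq w0)
    qed
    have int: "integrable lborel (u k)" for k
    proof (rule Bochner_Integration.integrable_bound[OF _ meas])
      show "integrable lborel (\<lambda>t. norm (w t) * (M * q ^ k))"
        by (intro integrable_mult_left integrable_norm w)
      show "AE t in lborel. norm (u k t) \<le> norm (norm (w t) * (M * q ^ k))"
        using bound[of k] M0 q by (intro AE_I2) (simp add: abs_mult)
    qed
    \<comment> \<open>The constant \<open>C\<close> is instantiated twice: by
      \<open>norm (w t)\<close> for the pointwise series, and by the integral of
      \<open>norm (w t)\<close> for the series of integrals.\<close>
    have sq: "summable (\<lambda>k. C * (M * q ^ k))" for C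
      using q by (intro summable_mult summable_geometric) auto
    have s1: "AE t in lborel. summable (\<lambda>k. norm (u k t))"
      by (intro AE_I2 summable_comparison_test'[OF sq]) (use bound in auto)
    have s2: "summable (\<lambda>k. \<integral>t. norm (u k t) \<partial>lborel)"
    proof (rule summable_comparison_test'[OF sq])
      fix k
      have "(\<integral>t. norm (u k t) \<partial>lborel) \<le> (\<integral>t. norm (w t) * (M * q ^ k) \<partial>lborel)"
        by (intro integral_mono integrable_norm int bound integrable_mult_left w)
      thus "norm (\<integral>t. norm (u k t) \<partial>lborel) \<le> (\<integral>t. norm (w t) \<partial>lborel) * (M * q ^ k)"
        by simp
    qed
    have sum_eq: "(\<Sum>k. u k t) = w t * f (z * of_real t)" for t
    proof (cases "t \<in> {0..1}")
      case True
      have "dist (z0 * of_real t) (z * of_real t) = t * dist z0 z"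
        using True by (simp add: dist_norm norm_mult flip: left_diff_distrib)
      also have "\<dots> \<le> dist z0 z" using True by (intro mult_left_le_one_le) auto
      finally have "z * of_real t \<in> ball (z0 * of_real t) e" using z by auto
      hence "(\<lambda>k. (deriv ^^ k) f (z0 * of_real t) / fact k * (z * of_real t - z0 * of_real t) ^ k)
               sums f (z * of_real t)"
        by (intro holomorphic_power_series holomorphic_on_subset[OF holb[OF True]]) auto
      also have "(\<lambda>k. (deriv ^^ k) f (z0 * of_real t) / fact k * (z * of_real t - z0 * of_real t) ^ k) = (\<lambda>k. g k t)"
        by (simp add: g_def fun_eq_iff power_mult_distrib flip: left_diff_distrib)
      finally have "(\<lambda>k. w t * g k t) sums (w t * f (z * of_real t))" by (rule sums_mult)
      thus ?thesis by (simp add: u_eq sums_iff)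
    qed (simp add: u_eq w0)
    have iu: "(\<integral>t. u k t \<partial>lborel) = (\<integral>t. w t * (of_real t ^ k * (deriv ^^ k) f (z0 * of_real t) / fact k) \<partial>lborel)
             * (z - z0) ^ k" for k
      unfolding u_eq g_def by (simp add: mult.assoc flip: integral_mult_left_zero)
    show ?thesis
      using integrable_suminf[OF int s1 s2] integral_suminf[OF int s1 s2] summable_integral[OF int s1 s2]
      by (simp add: sum_eq iu sums_iff)
  qed
  show ?thesis using that[of e] main e(1) by blast
qed

text \<open>The expansion around each point of the slit plane gives holomorphy. At 0 the factor t^k
  raises \<alpha> to \<alpha> + k in the kernel, and the coefficient is Beta(\<alpha> + k, \<beta>)
  = Beta(\<alpha>, \<beta>) (\<alpha>)_k / (\<alpha> + \<beta>)_k times that of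
  \<open>f\<close>.\<close>

lemma euler_integral_slit_plane:
  assumes ab: "Re \<alpha> > 0" "Re \<beta> > 0"
    and f: "f holomorphic_on slit_plane" "f has_fps_expansion F"
  defines "g \<equiv> \<lambda>z. \<integral>t. beta_kernel \<alpha> \<beta> t * f (z * of_real t) \<partial>lborel"
  shows "z \<in> slit_plane \<Longrightarrow> integrable lborel (\<lambda>t. beta_kernel \<alpha> \<beta> t * f (z * of_real t))"
    and "g holomorphic_on slit_plane"
    and "g has_fps_expansion
           Abs_fps (\<lambda>k. Beta \<alpha> \<beta> * (pochhammer \<alpha> k / pochhammer (\<alpha> + \<beta>) k) * fps_nth F k)"
proof -
  have bk0: "t \<notin> {0..1} \<Longrightarrow> beta_kernel \<alpha> \<beta> t = 0" for t
    by (rule beta_kernel_eq_0) auto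
  have ps: "\<exists>r>0. \<forall>z\<in>ball z0 r. integrable lborel (\<lambda>t. beta_kernel \<alpha> \<beta> t * f (z * of_real t)) \<and>
       (\<lambda>k. (\<integral>t. beta_kernel \<alpha> \<beta> t * (of_real t ^ k * (deriv ^^ k) f (z0 * of_real t) / fact k) \<partial>lborel)
             * (z - z0) ^ k) sums g z" if "z0 \<in> slit_plane" for z0
    unfolding g_def
    by (rule kernel_integral_power_series[OF integrable_beta_kernel[OF ab] bk0 open_slit_plane f(1)
              segment_subset_slit_plane[OF that]]) blast+
  show "integrable lborel (\<lambda>t. beta_kernel \<alpha> \<beta> t * f (z * of_real t))" if "z \<in> slit_plane" for z
    using ps[OF that] centre_in_ball by blast
  show "g holomorphic_on slit_plane"
    unfolding analytic_on_open[OF open_slit_plane, symmetric] analytic_on_def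
  proof
    fix z assume "z \<in> slit_plane"
    then obtain r where "r > 0" "\<And>w. w \<in> ball z r \<Longrightarrow>
       (\<lambda>k. (\<integral>t. beta_kernel \<alpha> \<beta> t * (of_real t ^ k * (deriv ^^ k) f (z * of_real t) / fact k) \<partial>lborel)
             * (w - z) ^ k) sums g w" using ps by blast
    thus "\<exists>e>0. g holomorphic_on ball z e"
      by (intro exI[of _ r] conjI power_series_holomorphic)
  qed
  show "g has_fps_expansion
           Abs_fps (\<lambda>k. Beta \<alpha> \<beta> * (pochhammer \<alpha> k / pochhammer (\<alpha> + \<beta>) k) * fps_nth F k)" (is "_ has_fps_expansion ?G")
  proof (rule has_fps_expansionI)
    obtain r where r: "r > 0" "\<And>z. z \<in> ball 0 r \<Longrightarrow>
       (\<lambda>k. (\<integral>t. beta_kernel \<alpha> \<beta> t * (of_real t ^ k * (deriv ^^ k) f (0 * of_real t) / fact k) \<partial>lborel)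
             * (z - 0) ^ k) sums g z"
      using ps[OF zero_in_slit_plane] by blast
    have F: "(deriv ^^ k) f 0 / fact k = fps_nth F k" for k
      using fps_expansion_eqI[OF f(2)] by (auto simp: fps_expansion_def)
    have coeff: "(\<integral>t. beta_kernel \<alpha> \<beta> t * (of_real t ^ k * (deriv ^^ k) f (0 * of_real t) / fact k) \<partial>lborel) = fps_nth ?G k" for k
    proof -
      have "(\<integral>t. beta_kernel \<alpha> \<beta> t * (of_real t ^ k * (deriv ^^ k) f (0 * of_real t) / fact k) \<partial>lborel) =
            (\<integral>t. beta_kernel (\<alpha> + of_nat k) \<beta> t * fps_nth F k \<partial>lborel)"
        by (simp add: F mult.assoc flip: F beta_kernel_mult_power)
      also have "\<dots> = Beta (\<alpha> + of_nat k) \<beta> * fps_nth F k"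
        using ab by (simp add: integral_beta_kernel)
      also have "Beta (\<alpha> + of_nat k) \<beta> = Beta \<alpha> \<beta> * (pochhammer \<alpha> k / pochhammer (\<alpha> + \<beta>) k)"
      proof -
        have nz: "\<alpha> \<notin> \<int>\<^sub>\<le>\<^sub>0" "\<alpha> + \<beta> \<notin> \<int>\<^sub>\<le>\<^sub>0"
          using ab by (auto intro!: pos_Re_not_nonpos_Int)
        have "Gamma (\<alpha> + of_nat k) = pochhammer \<alpha> k * Gamma \<alpha>"
             "Gamma (\<alpha> + \<beta> + of_nat k) = pochhammer (\<alpha> + \<beta>) k * Gamma (\<alpha> + \<beta>)"
          using nz by (simp_all add: pochhammer_Gamma Gamma_eq_zero_iff)
        thus ?thesis by (simp add: Beta_def add_ac mult_ac)
      qed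
      finally show ?thesis by simp
    qed
    show "\<forall>\<^sub>F u in nhds 0. (\<lambda>n. fps_nth ?G n * u ^ n) sums g u"
    proof (rule eventually_mono)
      show "\<forall>\<^sub>F u in nhds 0. u \<in> ball (0::complex) r"
        using r(1) by (intro eventually_nhds_in_open) auto
      show "(\<lambda>n. fps_nth ?G n * u ^ n) sums g u" if "u \<in> ball 0 r" for u
        using r(2)[OF that] unfolding coeff by simp
    qed
  qed
qed

section \<open>The coefficient multipliers (b)_k / (c)_k for general parameters\<close>

lemma slit_plane_shift:
  assumes f: "f holomorphic_on slit_plane" "f has_fps_expansion F"
  obtains g where "g holomorphic_on slit_plane" "g has_fps_expansion fps_shift 1 F"
proof -
  define f1 where "f1 = (\<lambda>z. f z - f 0)"
  have e1: "f1 has_fps_expansion F - fps_const (f 0)"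
    unfolding f1_def by (intro has_fps_expansion_diff f has_fps_expansion_const)
  \<comment> \<open>Dividing by z shifts the coefficients; the removable singularity at 0 is filled
    with the derivative of \<open>f1\<close>.\<close>
  define g where "g = (\<lambda>z. if z = 0 then deriv f1 0 else f1 z / z)"
  have hol: "g holomorphic_on slit_plane"
  proof (rule pole_theorem_open_0[OF _ open_slit_plane])
    show "f1 holomorphic_on slit_plane" unfolding f1_def by (intro holomorphic_intros f)
  qed (auto simp: g_def f1_def)
  hence g: "g has_fps_expansion fps_expansion g 0"
    by (intro has_fps_expansion_fps_expansion[OF open_slit_plane]) auto
  have "(\<lambda>z. z * g z) has_fps_expansion fps_X * fps_expansion g 0"
    by (intro has_fps_expansion_mult has_fps_expansion_fps_X g)
  also have "(\<lambda>z. z * g z) = f1"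
    by (auto simp: g_def f1_def)
  finally have "fps_X * fps_expansion g 0 = F - fps_const (f 0)"
    using fps_expansion_eqI[OF e1] fps_expansion_eqI by metis
  hence "fps_shift 1 (fps_X * fps_expansion g 0) = fps_shift 1 (F - fps_const (f 0))"
    by simp
  hence "fps_expansion g 0 = fps_shift 1 F"
    by (simp add: fps_eq_iff)
  thus ?thesis using that hol g by metis
qed

text \<open>Only existence of the image function is asked for, so it need not be an integral and the
  notion survives where Euler's integral diverges. Quantifying over all \<open>f\<close> matters
  because the shift step below changes the input function.\<close>

definition slit_multiplier :: "(nat \<Rightarrow> complex) \<Rightarrow> bool" where
  "slit_multiplier m \<longleftrightarrow> (\<forall>f F. f holomorphic_on slit_plane \<longrightarrow> f has_fps_expansion F \<longrightarrow>
     (\<exists>g. g holomorphic_on slit_plane \<and> g has_fps_expansion Abs_fps (\<lambda>k. m k * fps_nth F k)))"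

text \<open>The Euler integral with exponents b and c - b realises the multiplier up to the factor
  \<open>Beta b (c - b)\<close>, which is nonzero because b, c - b and c have positive real
  part.\<close>

lemma slit_multiplier_euler:
  assumes "Re b > 0" "Re c > Re b"
  shows "slit_multiplier (\<lambda>k. pochhammer b k / pochhammer c k)"
  unfolding slit_multiplier_def
proof (intro allI impI)
  fix f F assume f: "f holomorphic_on slit_plane" "f has_fps_expansion F"
  define g where "g = (\<lambda>z. \<integral>t. beta_kernel b (c - b) t * f (z * of_real t) \<partial>lborel)"
  have g: "g holomorphic_on slit_plane" "g has_fps_expansion
      Abs_fps (\<lambda>k. Beta b (c - b) * (pochhammer b k / pochhammer c k) * fps_nth F k)"
    using euler_integral_slit_plane(2,3)[of b "c - b" f F] assms f by (simp_all add: g_def)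
  have nz: "Beta b (c - b) \<noteq> 0"
    using assms by (simp add: Beta_def Gamma_eq_zero_iff pos_Re_not_nonpos_Int)
  have "(\<lambda>z. inverse (Beta b (c - b)) * g z) has_fps_expansion
      fps_const (inverse (Beta b (c - b))) * Abs_fps (\<lambda>k. Beta b (c - b) * (pochhammer b k / pochhammer c k) * fps_nth F k)"
    by (intro has_fps_expansion_cmult_left g)
  also have "fps_const (inverse (Beta b (c - b))) * Abs_fps (\<lambda>k. Beta b (c - b) * (pochhammer b k / pochhammer c k) * fps_nth F k)
     = Abs_fps (\<lambda>k. pochhammer b k / pochhammer c k * fps_nth F k)"
    using nz by (simp add: fps_eq_iff)
  finally show "\<exists>g. g holomorphic_on slit_plane \<and>
        g has_fps_expansion Abs_fps (\<lambda>k. pochhammer b k / pochhammer c k * fps_nth F k)"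
    using g(1) by (intro exI conjI) (auto intro!: holomorphic_intros)
qed

text \<open>The operator \<open>f \<mapsto> f + z f' / c\<close> multiplies the \<open>k\<close>-th coefficient by \<open>(c + k) / c\<close>.\<close>

lemma slit_multiplier_lower:
  assumes m: "slit_multiplier (\<lambda>k. pochhammer b k / pochhammer (c + 1) k)" and c: "c \<noteq> 0"
    and cn: "c + 1 \<notin> \<int>\<^sub>\<le>\<^sub>0"
  shows "slit_multiplier (\<lambda>k. pochhammer b k / pochhammer c k)"
  unfolding slit_multiplier_def
proof (intro allI impI)
  fix f F assume "f holomorphic_on slit_plane" "f has_fps_expansion F"
  then obtain g where g: "g holomorphic_on slit_plane"
      "g has_fps_expansion Abs_fps (\<lambda>k. pochhammer b k / pochhammer (c + 1) k * fps_nth F k)"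
    using m unfolding slit_multiplier_def by blast
  let ?G = "Abs_fps (\<lambda>k. pochhammer b k / pochhammer (c + 1) k * fps_nth F k)"
  have "(\<lambda>z. g z + inverse c * (z * deriv g z)) has_fps_expansion ?G + fps_const (inverse c) * (fps_X * fps_deriv ?G)"
    by (intro has_fps_expansion_add has_fps_expansion_cmult_left has_fps_expansion_mult
          has_fps_expansion_fps_X has_fps_expansion_deriv g)
  also have "?G + fps_const (inverse c) * (fps_X * fps_deriv ?G) =
      Abs_fps (\<lambda>k. pochhammer b k / pochhammer c k * fps_nth F k)"
  proof (rule fps_ext)
    fix k
    have "c * pochhammer (c + 1) k = pochhammer c k * (c + of_nat k)"
      using pochhammer_rec[of c k] pochhammer_rec'[of c k] by (simp add: mult_ac)
    moreover have "pochhammer (c + 1) k \<noteq> 0" by (rule pochhammer_nz[OF cn])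
    ultimately have "inverse (pochhammer (c + 1) k) * ((c + of_nat k) / c) = inverse (pochhammer c k)"
      using c by (cases "pochhammer c k = 0") (auto simp: field_simps)
    moreover have "fps_nth (fps_X * fps_deriv ?G) k = of_nat k * fps_nth ?G k"
      by (cases k) auto
    hence "fps_nth (?G + fps_const (inverse c) * (fps_X * fps_deriv ?G)) k =
        pochhammer b k * (inverse (pochhammer (c + 1) k) * ((c + of_nat k) / c)) * fps_nth F k"
      using c by (simp add: divide_simps) (simp add: algebra_simps)
    ultimately show "fps_nth (?G + fps_const (inverse c) * (fps_X * fps_deriv ?G)) k =
      fps_nth (Abs_fps (\<lambda>k. pochhammer b k / pochhammer c k * fps_nth F k)) k"
      by (simp add: divide_inverse)
  qed
  finally show "\<exists>g. g holomorphic_on slit_plane \<and>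
        g has_fps_expansion Abs_fps (\<lambda>k. pochhammer b k / pochhammer c k * fps_nth F k)"
    using g(1) by (intro exI conjI) (auto intro!: holomorphic_intros open_slit_plane)
qed

text \<open>Since (b)_(k+1) / (c)_(k+1) = (b / c) (b+1)_k / (c+1)_k, one removes the constant term,
  divides by z, applies the raised multiplier, multiplies by b z / c and restores the constant
  term.\<close>

lemma slit_multiplier_shift:
  assumes m: "slit_multiplier (\<lambda>k. pochhammer (b + 1) k / pochhammer (c + 1) k)"
  shows "slit_multiplier (\<lambda>k. pochhammer b k / pochhammer c k)"
  unfolding slit_multiplier_def
proof (intro allI impI)
  fix f F assume "f holomorphic_on slit_plane" "f has_fps_expansion F"
  then obtain f1 where "f1 holomorphic_on slit_plane" "f1 has_fps_expansion fps_shift 1 F"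
    using slit_plane_shift by blast
  then obtain g where g: "g holomorphic_on slit_plane"
      "g has_fps_expansion Abs_fps (\<lambda>k. pochhammer (b + 1) k / pochhammer (c + 1) k * fps_nth (fps_shift 1 F) k)"
    using m unfolding slit_multiplier_def by blast
  let ?G = "Abs_fps (\<lambda>k. pochhammer (b + 1) k / pochhammer (c + 1) k * fps_nth (fps_shift 1 F) k)"
  have "(\<lambda>z. fps_nth F 0 + b / c * (z * g z)) has_fps_expansion fps_const (fps_nth F 0) + fps_const (b / c) * (fps_X * ?G)"
    by (intro has_fps_expansion_add has_fps_expansion_cmult_left has_fps_expansion_mult
          has_fps_expansion_fps_X has_fps_expansion_const g)
  also have "fps_const (fps_nth F 0) + fps_const (b / c) * (fps_X * ?G) =
      Abs_fps (\<lambda>k. pochhammer b k / pochhammer c k * fps_nth F k)"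
  proof (rule fps_ext)
    fix k
    show "fps_nth (fps_const (fps_nth F 0) + fps_const (b / c) * (fps_X * ?G)) k =
        fps_nth (Abs_fps (\<lambda>k. pochhammer b k / pochhammer c k * fps_nth F k)) k"
      by (cases k) (simp_all add: pochhammer_rec)
  qed
  finally show "\<exists>g. g holomorphic_on slit_plane \<and>
        g has_fps_expansion Abs_fps (\<lambda>k. pochhammer b k / pochhammer c k * fps_nth F k)"
    using g(1) by (intro exI conjI) (auto intro!: holomorphic_intros)
qed

text \<open>Two inductions reduce to the Euler case. For Re b > 0, raising c by 1 at a time reaches
  Re c > Re b (\<open>pos\<close>); for general b, raising b and c together reaches Re b > 0
  (\<open>all\<close>). In both, \<open>n\<close> bounds the number of steps.\<close>

lemma slit_multiplier_pochhammer:
  assumes c: "c \<notin> \<int>\<^sub>\<le>\<^sub>0"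
  shows "slit_multiplier (\<lambda>k. pochhammer b k / pochhammer c k)"
proof -
  have step: "c + 1 \<notin> \<int>\<^sub>\<le>\<^sub>0" if "c \<notin> \<int>\<^sub>\<le>\<^sub>0" for c :: complex
    using that plus_one_in_nonpos_Ints_imp by blast
  have pos: "slit_multiplier (\<lambda>k. pochhammer b k / pochhammer c k)"
    if "Re b > 0" "c \<notin> \<int>\<^sub>\<le>\<^sub>0" "Re c + real n > Re b" for n b c
    using that
  proof (induction n arbitrary: c)
    case 0
    thus ?case by (intro slit_multiplier_euler) auto
  next
    case (Suc n)
    show ?case
      by (rule slit_multiplier_lower[OF Suc.IH]) (use Suc.prems step in auto)
  qed
  have all: "slit_multiplier (\<lambda>k. pochhammer b k / pochhammer c k)"
    if "c \<notin> \<int>\<^sub>\<le>\<^sub>0" "Re b + real n > 0" for n b c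
    using that
  proof (induction n arbitrary: b c)
    case 0
    obtain m where "Re b - Re c < real m" using reals_Archimedean2 by blast
    with 0 show ?case by (intro pos[of b c m]) auto
  next
    case (Suc n)
    show ?case
      by (rule slit_multiplier_shift[OF Suc.IH]) (use Suc.prems step in auto)
  qed
  obtain n where "- Re b < real n" using reals_Archimedean2 by blast
  thus ?thesis using c by (intro all[of c b n]) auto
qed

subsection \<open>Existence of the analytic continuation\<close>

definition hyp_fps :: "complex \<Rightarrow> complex \<Rightarrow> complex \<Rightarrow> complex fps" where
  "hyp_fps a b c = Abs_fps (\<lambda>k. pochhammer a k * pochhammer b k / (pochhammer c k * fact k))"

text \<open>The binomial series of (1 - z)^s, with the alternating sign absorbed into the rising
  factorial of -s.\<close>

definition pow_fps :: "complex \<Rightarrow> complex fps" where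
  "pow_fps s = Abs_fps (\<lambda>k. pochhammer (- s) k / fact k)"

lemma one_minus_powr_holomorphic: "(\<lambda>z. (1 - z) powr s) holomorphic_on slit_plane"
  by (intro holomorphic_intros) (use slit_plane_iff in auto)

lemma one_minus_powr_has_fps_expansion: "(\<lambda>z. (1 - z) powr s) has_fps_expansion pow_fps s"
proof (rule has_fps_expansionI)
  have "(\<lambda>n. fps_nth (pow_fps s) n * z ^ n) sums ((1 - z) powr s)" if "z \<in> ball 0 1" for z
  proof -
    have "(s gchoose n) * (- z) ^ n = fps_nth (pow_fps s) n * z ^ n" for n
      by (cases "even n") (simp_all add: pow_fps_def gbinomial_pochhammer)
    thus ?thesis using gen_binomial_complex[of "-z" s] that by simp
  qed
  thus "\<forall>\<^sub>F z in nhds 0. (\<lambda>n. fps_nth (pow_fps s) n * z ^ n) sums ((1 - z) powr s)"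
    using eventually_nhds_in_open[of "ball 0 1" "0::complex"] by (auto elim!: eventually_mono)
qed

text \<open>Because \<open>hyp2F1\<close> is defined by choice, a witness must be exhibited before
  anything can be said about it. The multiplier (b)_k / (c)_k applied to (1 - z)^(-a) supplies
  one.\<close>

lemma hyp2F1_continuation:
  assumes c: "c \<notin> \<int>\<^sub>\<le>\<^sub>0"
  shows hyp2F1_holomorphic: "hyp2F1 a b c holomorphic_on slit_plane"
    and hyp2F1_has_fps_expansion: "hyp2F1 a b c has_fps_expansion hyp_fps a b c"
proof -
  obtain F where F: "F holomorphic_on slit_plane"
      "F has_fps_expansion Abs_fps (\<lambda>k. pochhammer b k / pochhammer c k * fps_nth (pow_fps (-a)) k)"
    using slit_multiplier_pochhammer[OF c] one_minus_powr_holomorphic one_minus_powr_has_fps_expansion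
    unfolding slit_multiplier_def by blast
  have "Abs_fps (\<lambda>k. pochhammer b k / pochhammer c k * fps_nth (pow_fps (-a)) k) = hyp_fps a b c"
    by (simp add: hyp_fps_def pow_fps_def mult_ac)
  with F have F2: "F has_fps_expansion hyp_fps a b c" by simp
  \<comment> \<open>An expansion at 0 speaks only of a neighbourhood; holomorphy on the unit disc
    extends convergence to all of it.\<close>
  have "(\<lambda>k. fps_nth (hyp_fps a b c) k * z ^ k) sums F z" if "norm z < 1" for z
    using that ball_subset_slit_plane
    by (intro has_fps_expansion_imp_sums_complex[OF F2, of 1])
       (auto intro!: holomorphic_on_subset[OF F(1)] simp: one_ereal_def)
  hence ex: "\<exists>F. F holomorphic_on slit_plane \<and> (\<forall>z. norm z < 1 \<longrightarrow>
        (\<lambda>k. pochhammer a k * pochhammer b k / (pochhammer c k * fact k) * z ^ k) sums F z)"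
    using F(1) by (auto simp: hyp_fps_def)
  note spec = someI_ex[OF ex, folded hyp2F1_def]
  show "hyp2F1 a b c holomorphic_on slit_plane" using spec by blast
  show "hyp2F1 a b c has_fps_expansion hyp_fps a b c"
  proof (rule has_fps_expansionI)
    show "\<forall>\<^sub>F z in nhds 0. (\<lambda>n. fps_nth (hyp_fps a b c) n * z ^ n) sums hyp2F1 a b c z"
      using eventually_nhds_in_open[of "ball 0 1" "0::complex"] spec
      by (auto elim!: eventually_mono simp: hyp_fps_def)
  qed
qed

subsection \<open>Euler's transformation\<close>

text \<open>On coefficients, the operator z (1 - z) F'' + (c - (a + b + 1) z) F' - a b F becomes a
  two-term recurrence, which serves both to verify and to solve the hypergeometric equation.\<close>

lemma fps_nth_hypergeometric_operator:
  fixes F :: "complex fps"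
  shows "fps_nth (fps_X * (1 - fps_X) * fps_deriv (fps_deriv F)
           + (fps_const c - (fps_const a + fps_const b + 1) * fps_X) * fps_deriv F
           - fps_const a * fps_const b * F) n
         = of_nat (Suc n) * (c + of_nat n) * fps_nth F (Suc n) - (a + of_nat n) * (b + of_nat n) * fps_nth F n"
proof -
  have "fps_X * (1 - fps_X) * fps_deriv (fps_deriv F)
           + (fps_const c - (fps_const a + fps_const b + 1) * fps_X) * fps_deriv F
           - fps_const a * fps_const b * F
      = fps_X * fps_deriv (fps_deriv F) - fps_X * (fps_X * fps_deriv (fps_deriv F))
           + fps_const c * fps_deriv F - fps_const a * (fps_X * fps_deriv F)
           - fps_const b * (fps_X * fps_deriv F) - fps_X * fps_deriv F
           - fps_const a * (fps_const b * F)"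
    by (simp add: algebra_simps del: fps_const_add fps_const_mult)
  moreover have "fps_nth \<dots> n = of_nat (Suc n) * (c + of_nat n) * fps_nth F (Suc n) - (a + of_nat n) * (b + of_nat n) * fps_nth F n"
    \<comment> \<open>Multiplying by \<open>fps_X\<close> twice shifts indices by two, so n = 0, n =
      1 and n >= 2 are separated.\<close>
    by (cases n; cases "n - 1") (simp_all add: algebra_simps)
  ultimately show ?thesis by simp
qed

lemma hyp_fps_ODE:
  assumes "c \<notin> \<int>\<^sub>\<le>\<^sub>0"
  shows "fps_X * (1 - fps_X) * fps_deriv (fps_deriv (hyp_fps a b c))
           + (fps_const c - (fps_const a + fps_const b + 1) * fps_X) * fps_deriv (hyp_fps a b c)
           - fps_const a * fps_const b * hyp_fps a b c = 0"
proof (rule fps_ext)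
  fix n
  have "c + of_nat n \<noteq> 0" using pochhammer_nz[OF assms, of "Suc n"] by (auto simp: pochhammer_rec')
  moreover have "(1 + of_nat n :: complex) \<noteq> 0" by (metis of_nat_Suc of_nat_neq_0)
  ultimately have "of_nat (Suc n) * (c + of_nat n) * fps_nth (hyp_fps a b c) (Suc n) = (a + of_nat n) * (b + of_nat n) * fps_nth (hyp_fps a b c) n"
    using pochhammer_nz[OF assms, of n]
    by (simp add: hyp_fps_def pochhammer_rec' divide_simps)
  thus "fps_nth (fps_X * (1 - fps_X) * fps_deriv (fps_deriv (hyp_fps a b c))
           + (fps_const c - (fps_const a + fps_const b + 1) * fps_X) * fps_deriv (hyp_fps a b c)
           - fps_const a * fps_const b * hyp_fps a b c) n = fps_nth 0 n"
    unfolding fps_nth_hypergeometric_operator by simp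
qed

text \<open>The leading factor (n + 1) (c + n) never vanishes, so the recurrence determines each
  coefficient from its predecessor.\<close>

lemma hyp_fps_unique:
  assumes c: "c \<notin> \<int>\<^sub>\<le>\<^sub>0"
    and ode: "fps_X * (1 - fps_X) * fps_deriv (fps_deriv F)
           + (fps_const c - (fps_const a + fps_const b + 1) * fps_X) * fps_deriv F
           - fps_const a * fps_const b * F = 0"
    and F0: "fps_nth F 0 = 1"
  shows "F = hyp_fps a b c"
proof (rule fps_ext)
  have rec: "of_nat (Suc n) * (c + of_nat n) * fps_nth G (Suc n) = (a + of_nat n) * (b + of_nat n) * fps_nth G n"
    if "G = F \<or> G = hyp_fps a b c" for G n
  proof -
    have "fps_X * (1 - fps_X) * fps_deriv (fps_deriv G)
           + (fps_const c - (fps_const a + fps_const b + 1) * fps_X) * fps_deriv G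
           - fps_const a * fps_const b * G = 0"
      using that ode hyp_fps_ODE[OF c, of a b] by metis
    from this[unfolded fps_eq_iff fps_nth_hypergeometric_operator] show ?thesis by simp
  qed
  fix n show "fps_nth F n = fps_nth (hyp_fps a b c) n"
  proof (induction n)
    case 0 thus ?case by (simp add: F0 hyp_fps_def)
  next
    case (Suc n)
    have "c + of_nat n \<noteq> 0" using pochhammer_nz[OF c, of "Suc n"] by (auto simp: pochhammer_rec')
    hence "of_nat (Suc n) * (c + of_nat n) \<noteq> 0" by (simp del: of_nat_Suc)
    moreover have "of_nat (Suc n) * (c + of_nat n) * fps_nth F (Suc n) = of_nat (Suc n) * (c + of_nat n) * fps_nth (hyp_fps a b c) (Suc n)"
      using rec[of F n] rec[of "hyp_fps a b c" n] Suc by simp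
    ultimately show ?case by simp
  qed
qed

text \<open>The formal version of differentiating (1 - z)^s. Euler's transformation uses no other
  property of the power except its constant term.\<close>

lemma pow_fps_ODE: "(1 - fps_X) * fps_deriv (pow_fps s) = - (fps_const s * pow_fps s)"
proof (rule fps_ext)
  fix n
  have "of_nat (Suc n) * fps_nth (pow_fps s) (Suc n) = (of_nat n - s) * fps_nth (pow_fps s) n"
    by (simp add: pow_fps_def pochhammer_rec' del: of_nat_Suc)
  moreover have "fps_nth (fps_X * fps_deriv (pow_fps s)) n = of_nat n * fps_nth (pow_fps s) n"
    by (cases n) simp_all
  ultimately show "fps_nth ((1 - fps_X) * fps_deriv (pow_fps s)) n = fps_nth (- (fps_const s * pow_fps s)) n"
    by (simp add: left_diff_distrib)
qed

text \<open>Here \<open>P\<close>, \<open>P1\<close>, \<open>P2\<close> and \<open>F\<close>,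
  \<open>F1\<close>, \<open>F2\<close> stand for a function and its first two derivatives, with P =
  (1 - z)^(a+b-c). Replacing derivatives by independent ring elements leaves pure algebra. The extra
  factor \<open>1 - X\<close> in the conclusion allows \<open>2\<close> and \<open>3\<close> to be
  used without dividing.\<close>

lemma euler_transformation_ring_identity:
  fixes X A B C P P1 P2 F F1 F2 :: "'a :: comm_ring_1"
  assumes 1: "X * (1 - X) * F2 + (C - (A + B + 1) * X) * F1 - A * B * F = 0"
    and 2: "(1 - X) * P1 = - ((A + B - C) * P)"
    and 3: "(1 - X) * P2 - P1 = - ((A + B - C) * P1)"
  shows "(1 - X) * (X * (1 - X) * (P2 * F + 2 * (P1 * F1) + P * F2)
           + (C - ((C - A) + (C - B) + 1) * X) * (P1 * F + P * F1)
           - (C - A) * (C - B) * (P * F)) = 0"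
proof -
  define s where "s = A + B - C"
  have p1: "(1 - X) * P1 + s * P = 0" using 2 by (simp add: s_def)
  have p2: "(1 - X) * P2 - P1 + s * P1 = 0" using 3 by (simp add: s_def)
  have C: "C = A + B - s" by (simp add: s_def)
  \<comment> \<open>The expression is written as an explicit combination of the left sides of
    \<open>1\<close>, \<open>p2\<close> and \<open>p1\<close>, all zero. Once \<open>C\<close> is
    eliminated in favour of \<open>s\<close>, this is a polynomial identity.\<close>
  have "(1 - X) * (X * (1 - X) * (P2 * F + 2 * (P1 * F1) + P * F2)
           + (C - ((C - A) + (C - B) + 1) * X) * (P1 * F + P * F1)
           - (C - A) * (C - B) * (P * F)) 
    = (1 - X) * P * (X * (1 - X) * F2 + (C - (A + B + 1) * X) * F1 - A * B * F)
      + X * (1 - X) * F * ((1 - X) * P2 - P1 + s * P1)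
      + (2 * X * (1 - X) * F1 + (1 - s) * X * F + (C - ((C - A) + (C - B) + 1) * X) * F) * ((1 - X) * P1 + s * P)"
    unfolding C by (simp add: algebra_simps)
  thus ?thesis unfolding 1 p1 p2 by simp
qed

text \<open>The product satisfies the hypergeometric equation with parameters c - a, c - b, c up to
  a factor \<open>1 - fps_X\<close>. That factor cancels in the integral domain of power series, and
  uniqueness with constant term 1 applies.\<close>

lemma hyp_fps_euler_transformation:
  assumes c: "c \<notin> \<int>\<^sub>\<le>\<^sub>0"
  shows "pow_fps (a + b - c) * hyp_fps a b c = hyp_fps (c - a) (c - b) c"
proof (rule hyp_fps_unique[OF c])
  let ?P = "pow_fps (a + b - c)" and ?F = "hyp_fps a b c"
  let ?A = "fps_const a" and ?B = "fps_const b" and ?C = "fps_const c"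
  have P1: "(1 - fps_X) * fps_deriv ?P = - ((?A + ?B - ?C) * ?P)"
    using pow_fps_ODE[of "a + b - c"] by simp
  have "fps_deriv ((1 - fps_X) * fps_deriv ?P) = fps_deriv (- ((?A + ?B - ?C) * ?P))"
    by (simp only: P1)
  hence P2: "(1 - fps_X) * fps_deriv (fps_deriv ?P) - fps_deriv ?P = - ((?A + ?B - ?C) * fps_deriv ?P)"
    by simp
  have "(1 - fps_X :: complex fps) \<noteq> 0"
    by (auto simp: fps_eq_iff intro!: exI[of _ 0])
  moreover have Q1: "fps_deriv (?P * ?F) = fps_deriv ?P * ?F + ?P * fps_deriv ?F"
    by (simp add: algebra_simps)
  moreover have Q2: "fps_deriv (fps_deriv (?P * ?F)) =
      fps_deriv (fps_deriv ?P) * ?F + 2 * (fps_deriv ?P * fps_deriv ?F) + ?P * fps_deriv (fps_deriv ?F)"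
    by (simp add: algebra_simps)
  ultimately show "fps_X * (1 - fps_X) * fps_deriv (fps_deriv (?P * ?F))
           + (?C - (fps_const (c - a) + fps_const (c - b) + 1) * fps_X) * fps_deriv (?P * ?F)
           - fps_const (c - a) * fps_const (c - b) * (?P * ?F) = 0"
    using euler_transformation_ring_identity[OF hyp_fps_ODE[OF c, of a b] P1 P2]
    unfolding Q1 Q2 fps_const_sub[symmetric] by (metis mult_eq_0_iff)
  show "fps_nth (?P * ?F) 0 = 1"
    by (simp add: pow_fps_def hyp_fps_def)
qed

lemma hyp2F1_euler_transformation:
  assumes c: "c \<notin> \<int>\<^sub>\<le>\<^sub>0" and z: "z \<in> slit_plane"
  shows "(1 - z) powr (a + b - c) * hyp2F1 a b c z = hyp2F1 (c - a) (c - b) c z"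
proof (rule eq_on_slit_plane_if_same_fps[OF _ hyp2F1_holomorphic[OF c] _ hyp2F1_has_fps_expansion[OF c] z])
  show "(\<lambda>z. (1 - z) powr (a + b - c) * hyp2F1 a b c z) holomorphic_on slit_plane"
    by (intro holomorphic_on_mult one_minus_powr_holomorphic hyp2F1_holomorphic c)
  show "(\<lambda>z. (1 - z) powr (a + b - c) * hyp2F1 a b c z) has_fps_expansion hyp_fps (c - a) (c - b) c"
    unfolding hyp_fps_euler_transformation[OF c, symmetric]
    by (intro has_fps_expansion_mult one_minus_powr_has_fps_expansion hyp2F1_has_fps_expansion c)
qed

subsection \<open>The fractional integral\<close>

text \<open>The multiplier (\<alpha>)_k / (\<alpha> + \<beta>)_k cancels the upper parameter
  \<alpha> + \<beta> from every coefficient and puts \<alpha> in its place.\<close>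

lemma hyp2F1_euler_integral:
  assumes c: "c \<notin> \<int>\<^sub>\<le>\<^sub>0" and ab: "Re \<alpha> > 0" "Re \<beta> > 0" and z: "z \<in> slit_plane"
  shows "(\<integral>t. beta_kernel \<alpha> \<beta> t * hyp2F1 (\<alpha> + \<beta>) b c (z * of_real t) \<partial>lborel) = Beta \<alpha> \<beta> * hyp2F1 \<alpha> b c z"
proof (rule eq_on_slit_plane_if_same_fps[OF _ _ _ _ z])
  note E = euler_integral_slit_plane[OF ab hyp2F1_holomorphic[OF c] hyp2F1_has_fps_expansion[OF c]]
  show "(\<lambda>z. \<integral>t. beta_kernel \<alpha> \<beta> t * hyp2F1 (\<alpha> + \<beta>) b c (z * of_real t) \<partial>lborel) holomorphic_on slit_plane"
    by (rule E)
  show "(\<lambda>z. Beta \<alpha> \<beta> * hyp2F1 \<alpha> b c z) holomorphic_on slit_plane"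
    by (intro holomorphic_intros hyp2F1_holomorphic c)
  have nz: "pochhammer (\<alpha> + \<beta>) k \<noteq> 0" for k
    using ab by (intro pochhammer_nz pos_Re_not_nonpos_Int) auto
  have eq: "fps_const (Beta \<alpha> \<beta>) * hyp_fps \<alpha> b c =
     Abs_fps (\<lambda>k. Beta \<alpha> \<beta> * (pochhammer \<alpha> k / pochhammer (\<alpha> + \<beta>) k) * fps_nth (hyp_fps (\<alpha> + \<beta>) b c) k)"
    using nz by (simp add: fps_eq_iff hyp_fps_def)
  show "(\<lambda>z. Beta \<alpha> \<beta> * hyp2F1 \<alpha> b c z) has_fps_expansion fps_const (Beta \<alpha> \<beta>) * hyp_fps \<alpha> b c"
    by (intro has_fps_expansion_cmult_left hyp2F1_has_fps_expansion c)
  show "(\<lambda>z. \<integral>t. beta_kernel \<alpha> \<beta> t * hyp2F1 (\<alpha> + \<beta>) b c (z * of_real t) \<partial>lborel) has_fps_expansion fps_const (Beta \<alpha> \<beta>) * hyp_fps \<alpha> b c"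
    unfolding eq by (rule E)
qed

theorem mainTheorem3:
  fixes a b c \<mu> :: complex and x :: real
  assumes "c \<notin> \<int>\<^sub>\<le>\<^sub>0"
    and "Re (c - a) > Re \<mu>" and "Re \<mu> > 0"
    and "x \<in> {..<0} \<union> {0<..<1}"
  defines "f \<equiv> \<lambda>y::real.
      of_real \<bar>y\<bar> powr (c - a - \<mu> - 1) * of_real (1 - y) powr (a + b - c)
      * hyp2F1 a b c (of_real y) * (of_real \<bar>x - y\<bar> powr (\<mu> - 1) / Gamma \<mu>)"
  shows "set_integrable lborel {y. 0 < y / x \<and> y / x < 1} f
    \<and> (LBINT y:{y. 0 < y / x \<and> y / x < 1}. f y)
      = Gamma (c - a - \<mu>) / Gamma (c - a)
        * of_real \<bar>x\<bar> powr (c - a - 1) * of_real (1 - x) powr (a + b - c + \<mu>)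
        * hyp2F1 (a + \<mu>) b c (of_real x)"
proof -
  note c = assms(1)
  define \<alpha> where "\<alpha> = c - a - \<mu>"
  have \<alpha>: "Re \<alpha> > 0" "Re \<mu> > 0" "\<alpha> + \<mu> = c - a" using assms by (auto simp: \<alpha>_def)
  have x: "x \<noteq> 0" "x < 1" using assms by auto
  have slit: "complex_of_real y \<in> slit_plane" if "y < 1" for y
    using that by auto
  define g where "g = (\<lambda>t. beta_kernel \<alpha> \<mu> t * hyp2F1 (c - a) (c - b) c (of_real x * of_real t))"
  \<comment> \<open>\<open>K\<close> collects the powers of |x| released by |y| and |x - y|; the
    Jacobian will contribute one more factor |x|.\<close>
  define K where "K = of_real \<bar>x\<bar> powr (\<alpha> - 1) * of_real \<bar>x\<bar> powr (\<mu> - 1) / Gamma \<mu>"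
  define I where "I = {y. 0 < y / x \<and> y / x < 1}"
  \<comment> \<open>With y = x t the domain is 0 < t < 1 for either sign of x, and |x - y| = |x| (1
    - t). Euler's transformation applies because x t < 1.\<close>
  have subst: "indicator I (0 + x * t) *\<^sub>R f (0 + x * t) = K * g t" for t
  proof (cases "t \<in> {0<..<1}")
    case True
    have "x * t < 1"
    proof (cases "x > 0")
      case True
      have "x * t \<le> x" using True \<open>t \<in> _\<close> by (simp add: mult_le_cancel_left1)
      thus ?thesis using x by linarith
    next
      case False
      hence "x * t \<le> 0" using True by (simp add: mult_nonpos_nonneg)
      thus ?thesis by linarith
    qed
    hence "of_real (1 - x * t) powr (a + b - c) * hyp2F1 a b c (of_real (x * t)) =
           hyp2F1 (c - a) (c - b) c (of_real x * of_real t)"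
      using hyp2F1_euler_transformation[OF c slit, of "x * t" a b] by simp
    moreover have "\<bar>x - x * t\<bar> = \<bar>x\<bar> * (1 - t)" "\<bar>x * t\<bar> = \<bar>x\<bar> * t"
      using True abs_mult[of x "1 - t"] by (simp_all add: abs_mult algebra_simps)
    moreover have "f (x * t) = of_real \<bar>x * t\<bar> powr (\<alpha> - 1)
        * (of_real (1 - x * t) powr (a + b - c) * hyp2F1 a b c (of_real (x * t)))
        * (of_real \<bar>x - x * t\<bar> powr (\<mu> - 1) / Gamma \<mu>)"
      by (simp only: f_def \<alpha>_def mult.assoc)
    ultimately have "f (x * t) = of_real (\<bar>x\<bar> * t) powr (\<alpha> - 1) * hyp2F1 (c - a) (c - b) c (of_real x * of_real t)
        * (of_real (\<bar>x\<bar> * (1 - t)) powr (\<mu> - 1) / Gamma \<mu>)"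
      by (simp only:)
    also have "\<dots> = K * g t"
      using True by (simp only: of_real_mult)
        (simp add: powr_times_real K_def g_def beta_kernel_eq del: of_real_diff)
    finally show ?thesis using True x by (simp add: I_def)
  qed (use x in \<open>auto simp: g_def beta_kernel_eq_0 I_def\<close>)
  have "integrable lborel (\<lambda>t. K * g t)"
    unfolding g_def
    by (intro integrable_mult_right euler_integral_slit_plane(1)[OF \<alpha>(1,2) hyp2F1_holomorphic[OF c]
           hyp2F1_has_fps_expansion[OF c]] slit x)
  hence "integrable lborel (\<lambda>t. indicator I (0 + x * t) *\<^sub>R f (0 + x * t))"
    by (simp only: subst)
  hence int: "set_integrable lborel I f"
    unfolding set_integrable_def by (subst (asm) lborel_integrable_real_affine_iff[OF x(1)])
  have "(LBINT y:I. f y) = \<bar>x\<bar> *\<^sub>R (\<integral>t. K * g t \<partial>lborel)"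
    unfolding set_lebesgue_integral_def by (subst lborel_integral_real_affine[OF x(1), of _ 0]) (simp only: subst)
  also have "\<dots> = of_real \<bar>x\<bar> * K * (\<integral>t. g t \<partial>lborel)"
    by (simp add: scaleR_conv_of_real)
  also have "(\<integral>t. g t \<partial>lborel) = Beta \<alpha> \<mu> * hyp2F1 \<alpha> (c - b) c (of_real x)"
    using hyp2F1_euler_integral[OF c \<alpha>(1,2) slit[OF x(2)], of "c - b"] unfolding g_def \<alpha>(3) by simp
  \<comment> \<open>Euler's transformation read backwards, with a + \<mu> in place of a: then c - (a
    + \<mu>) = \<alpha>, and the exponent gains \<mu>.\<close>
  also have "hyp2F1 \<alpha> (c - b) c (of_real x) = of_real (1 - x) powr (a + b - c + \<mu>) * hyp2F1 (a + \<mu>) b c (of_real x)"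
    using hyp2F1_euler_transformation[OF c slit[OF x(2)], of "a + \<mu>" b] by (simp add: \<alpha>_def algebra_simps)
  \<comment> \<open>The exponents of |x| add up as 1 from the Jacobian, \<alpha> - 1 and \<mu> -
    1.\<close>
  also have "of_real \<bar>x\<bar> * K = of_real \<bar>x\<bar> powr (c - a - 1) / Gamma \<mu>"
  proof -
    have "of_real \<bar>x\<bar> powr (1 + ((\<alpha> - 1) + (\<mu> - 1))) = of_real \<bar>x\<bar> * (of_real \<bar>x\<bar> powr (\<alpha> - 1) * of_real \<bar>x\<bar> powr (\<mu> - 1))"
      using x by (subst powr_add, subst powr_add) simp
    moreover have "1 + ((\<alpha> - 1) + (\<mu> - 1)) = c - a - 1" by (simp add: \<alpha>_def)
    ultimately show ?thesis by (simp add: K_def)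
  qed
  also have "Beta \<alpha> \<mu> = Gamma (c - a - \<mu>) * Gamma \<mu> / Gamma (c - a)"
    by (simp add: Beta_def \<alpha>_def)
  finally have "(LBINT y:I. f y) = Gamma (c - a - \<mu>) / Gamma (c - a)
        * of_real \<bar>x\<bar> powr (c - a - 1) * of_real (1 - x) powr (a + b - c + \<mu>)
        * hyp2F1 (a + \<mu>) b c (of_real x)"
    using \<alpha>(2) by (simp add: Gamma_eq_zero_iff pos_Re_not_nonpos_Int)
  with int show ?thesis unfolding I_def by blast
qed

end
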